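(* For every integer $n\ge1$, the following identities hold, in inverse pairs: $$\Theta(n,1)=\sum_{i=1}^n S(n,i)\,(-1)^{i-1}i!\quad\leftrightarrow\quad(-1)^{n-1}n!=\sum_{i=1}^n s(n,i)\,\Theta(i,1),$$ $$(-1)^{n-1}n!=\sum_{i=1}^n\Theta(i,1)\,s(n,i)\quad\leftrightarrow\quad(-2)^{n-1}(n-1)!=\sum_{i=1}^n\theta(i,1)\,\overline{L}(n,i).$$
   Context: For integers $n,m\ge1$: $s(n,m)=(-2)^{n-m}c(n,m)$, where $c(n,m)$ is the unsigned Stirling number of the first kind; $S(n,m)=2^{n-m}\cdot$(Stirling number of the second kind, i.e. the number of partitions of an $n$-set into $m$ nonempty blocks); $\overline{L}(n,m)=(-1)^{n-m}\frac{n!}{m!}\binom{n-1}{m-1}$ is the scaled Lah number; and $\theta(n,m)$, $\Theta(n,m)$ are defined by $\sum_n\theta(n,m)\frac{u^n}{n!}=\frac1{m!}(\operatorname{artanh}u)^m$ and $\sum_n\Theta(n,m)\frac{u^n}{n!}=\frac1{m!}\tanh^m u$. The arrays $s,S$ are inverse to each other, and so are $\theta,\Theta$, i.e. $\sum_i a(n,i)A(i,m)=\sum_i A(n,i)a(i,m)=[m=n]$ (equal to $1$ if $m=n$ and $0$ otherwise) for $(a,A)=(s,S)$ and $(a,A)=(\theta,\Theta)$. The symbol $\leftrightarrow$ joins inverse relations: the first line is the $m=1$ case of $\Theta(n,m)=\sum_i S(n,i)\overline{L}(i,m)\leftrightarrow\overline{L}(n,m)=\sum_i s(n,i)\Theta(i,m)$,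 and the second line is the $m=1$ case of $\overline{L}(n,m)=\sum_i\Theta(i,m)s(n,i)\leftrightarrow s(n,m)=\sum_i\theta(i,m)\overline{L}(n,i)$. *)

theory Defs
  imports "HOL-Analysis.Analysis" "HOL-Combinatorics.Stirling"
begin

text \<open>
  All arrays are indexed by \<open>n, m \<ge> 1\<close>; their values outside this range carry no meaning.
  In the library, \<^const>\<open>stirling\<close> is the unsigned first kind and
  \<^const>\<open>Stirling\<close> the second kind.
\<close>

definition s_scaled :: "nat \<Rightarrow> nat \<Rightarrow> real" where
  "s_scaled n m = (-2) powi (int n - int m) * real (stirling n m)"

definition S_scaled :: "nat \<Rightarrow> nat \<Rightarrow> real" where
  "S_scaled n m = 2 powi (int n - int m) * real (Stirling n m)"

definition Lah_scaled :: "nat \<Rightarrow> nat \<Rightarrow> real" where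
  "Lah_scaled n m =
     (-1) powi (int n - int m) * (fact n / fact m) * real ((n - 1) choose (m - 1))"

definition fps_tanh :: "real fps" where
  "fps_tanh = (fps_exp 1 - fps_exp (-1)) / (fps_exp 1 + fps_exp (-1))"

text \<open>
  \<open>fps_ln 1\<close> is the series of \<open>ln (1 + u)\<close>, so this is
  \<open>(ln (1 + u) - ln (1 - u)) / 2\<close>.
\<close>

definition fps_artanh :: "real fps" where
  "fps_artanh = fps_const (1/2) * (fps_ln 1 - (fps_ln 1 oo (- fps_X)))"

definition theta :: "nat \<Rightarrow> nat \<Rightarrow> real" where
  "theta n m = fact n * fps_nth (fps_const (1 / fact m) * fps_artanh ^ m) n"

definition Theta :: "nat \<Rightarrow> nat \<Rightarrow> real" where
  "Theta n m = fact n * fps_nth (fps_const (1 / fact m) * fps_tanh ^ m) n"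

text \<open>
  Restricting the sums to \<open>i \<le> n\<close> is harmless for the lower triangular arrays above.
\<close>

definition inverse_arrays :: "(nat \<Rightarrow> nat \<Rightarrow> real) \<Rightarrow> (nat \<Rightarrow> nat \<Rightarrow> real) \<Rightarrow> bool" where
  "inverse_arrays a A \<longleftrightarrow>
     (\<forall>n\<ge>1. \<forall>m\<ge>1.
        (\<Sum>i=1..n. a n i * A i m) = (if m = n then 1 else 0) \<and>
        (\<Sum>i=1..n. A n i * a i m) = (if m = n then 1 else 0))"

text \<open>
  The two formal series are the expansions at 0 of the library functions \<^const>\<open>tanh\<close> and
  \<^const>\<open>artanh\<close>, and \<^const>\<open>Theta\<close> and \<^const>\<open>theta\<close> have the
  expected exponential generating functions.
\<close>

lemma has_fps_expansion_tanh: "tanh has_fps_expansion fps_tanh"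
proof -
  have "(\<lambda>x::real. (exp x - exp (-x)) / (exp x + exp (-x))) has_fps_expansion fps_tanh"
    unfolding fps_tanh_def by (intro fps_expansion_intros) auto
  also have "(\<lambda>x::real. (exp x - exp (-x)) / (exp x + exp (-x))) = tanh"
    by (rule ext) (simp add: tanh_altdef)
  finally show ?thesis .
qed

lemma has_fps_expansion_ln1p: "(\<lambda>x::real. ln (1 + x)) has_fps_expansion fps_ln 1"
proof -
  have "eval_fps (fps_ln 1) x = ln (1 + x)" if "\<bar>x\<bar> < 1" for x :: real
  proof -
    have "fps_nth (fps_ln 1) n * x ^ n = - ((- x) ^ n) / of_nat n" for n
      by (cases n) (simp_all add: fps_ln_nth power_minus')
    then show ?thesis
      using ln_series'[OF that] by (simp add: eval_fps_def sums_iff)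
  qed
  moreover have "eventually (\<lambda>x::real. x \<in> ball 0 1) (nhds 0)"
    by (intro eventually_nhds_in_open) auto
  ultimately show ?thesis
    by (auto simp: has_fps_expansion_def elim!: eventually_mono)
qed

lemma has_fps_expansion_ln1m:
  "(\<lambda>x::real. ln (1 - x)) has_fps_expansion (fps_ln 1 oo (- fps_X))"
proof -
  have eq: "eval_fps (fps_ln 1 oo (- fps_X)) x = eval_fps (fps_ln 1) (-x)" for x :: real
    unfolding eval_fps_def
    by (rule suminf_cong) (simp add: fps_compose_uminus' power_minus[of x])
  have "fps_conv_radius (fps_ln 1 oo (- fps_X) :: real fps) = fps_conv_radius (fps_ln 1 :: real fps)"
    unfolding fps_conv_radius_def
    by (rule conv_radius_cong) (simp add: fps_compose_uminus' abs_mult power_abs)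
  moreover have "eventually (\<lambda>x::real. eval_fps (fps_ln 1) (-x) = ln (1 + (-x))) (nhds 0)"
  proof -
    have "filterlim (\<lambda>x::real. -x) (nhds 0) (nhds 0)"
      using tendsto_minus[OF filterlim_ident[of "nhds (0::real)"]] by simp
    with has_fps_expansion_ln1p show ?thesis
      unfolding has_fps_expansion_def by (auto dest: eventually_compose_filterlim)
  qed
  ultimately show ?thesis
    by (simp add: has_fps_expansion_def eq)
qed

lemma has_fps_expansion_artanh: "artanh has_fps_expansion fps_artanh"
proof -
  have "(\<lambda>x::real. 1/2 * (ln (1 + x) - ln (1 - x))) has_fps_expansion fps_artanh"
    unfolding fps_artanh_def
    by (intro fps_expansion_intros has_fps_expansion_ln1p has_fps_expansion_ln1m)
  moreover have "eventually (\<lambda>x::real. x \<in> ball 0 1) (nhds 0)"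
    by (intro eventually_nhds_in_open) auto
  then have "eventually (\<lambda>x::real. 1/2 * (ln (1 + x) - ln (1 - x)) = artanh x) (nhds 0)"
    by eventually_elim (auto simp: artanh_def ln_div abs_less_iff)
  ultimately show ?thesis
    by (auto simp: has_fps_expansion_def elim: eventually_elim2)
qed

lemma has_fps_expansion_power':
  fixes f :: "real \<Rightarrow> real"
  assumes "f has_fps_expansion F"
  shows "(\<lambda>x. f x ^ m) has_fps_expansion F ^ m"
  using assms by (induction m) (auto intro!: fps_expansion_intros)

lemma theta_egf:
  "(\<lambda>u. 1 / fact m * artanh u ^ m) has_fps_expansion Abs_fps (\<lambda>n. theta n m / fact n)"
proof -
  have "Abs_fps (\<lambda>n. theta n m / fact n) = fps_const (1 / fact m) * fps_artanh ^ m"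
    by (simp add: fps_eq_iff theta_def)
  then show ?thesis
    by (simp only:) (intro fps_expansion_intros has_fps_expansion_power' has_fps_expansion_artanh)
qed

lemma Theta_egf:
  "(\<lambda>u. 1 / fact m * tanh u ^ m) has_fps_expansion Abs_fps (\<lambda>n. Theta n m / fact n)"
proof -
  have "Abs_fps (\<lambda>n. Theta n m / fact n) = fps_const (1 / fact m) * fps_tanh ^ m"
    by (simp add: fps_eq_iff Theta_def)
  then show ?thesis
    by (simp only:) (intro fps_expansion_intros has_fps_expansion_power' has_fps_expansion_tanh)
qed

end

theory Submission
  imports Defs
begin

text \<open>
  Attach to a power series \<open>f\<close> with zero constant term the array
  \<open>n! [u^n] f(u)^m / m!\<close>, called \<open>bell_array f\<close> below. Multiplying two such
  arrays amounts to composing their series, in reverse order (\<open>bell_array_compose\<close>), so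
  every identity between the arrays becomes an identity between series. All five arrays are of
  this kind:

    \<^item> \<open>s\<close> belongs to \<open>ln (1 + 2u) / 2\<close> and \<open>S\<close> to
      \<open>(exp (2u) - 1) / 2\<close>;
    \<^item> the scaled Lah numbers belong to \<open>u / (1 + u)\<close>;
    \<^item> \<open>\<theta>\<close> and \<open>\<Theta>\<close> belong to \<open>artanh\<close> and
      \<open>tanh\<close>, by definition.

  The two inverse pairs of arrays express that the two pairs of series are compositional inverses.
  The remaining identities all come from the single equation
  \<open>tanh u = y / (1 + y)\<close> with \<open>y = (exp (2u) - 1) / 2\<close>
  (\<open>lah_series_half_expm1\<close>): composing it on the right with the inverse of \<open>y\<close>
  gives \<open>tanh (ln (1 + 2u) / 2) = u / (1 + u)\<close>, and then composing on the left with
  \<open>artanh\<close> gives \<open>artanh (u / (1 + u)) = ln (1 + 2u) / 2\<close>. The first columns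
  of the corresponding array products are the stated sums.
\<close>

section \<open>The array of divided powers of a power series\<close>

text \<open>
  For \<open>f\<close> without constant term these are the partial Bell polynomials evaluated at
  the exponential coefficients of \<open>f\<close>.
\<close>
definition bell_array :: "real fps \<Rightarrow> nat \<Rightarrow> nat \<Rightarrow> real" where
  "bell_array f n m = fact n * fps_nth (fps_const (1 / fact m) * f ^ m) n"

lemma bell_array_1: "bell_array f n 1 = fact n * fps_nth f n"
  by (simp add: bell_array_def)

lemma bell_array_X: "bell_array fps_X n m = (if m = n then 1 else 0)"
  by (simp add: bell_array_def fps_X_power_nth)

text \<open>
  Expanding \<open>g(f(u))^m\<close> in powers of \<open>f\<close> produces the matrix product; the
  factors \<open>i!\<close> and \<open>1 / i!\<close> of the two arrays cancel. The summand
  \<open>i = 0\<close> drops out because the constant series \<open>f ^ 0\<close> has no coefficient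
  at \<open>n \<ge> 1\<close>.
\<close>
lemma bell_array_compose:
  assumes f0: "fps_nth f 0 = 0" and n: "n \<ge> 1"
  shows "(\<Sum>i=1..n. bell_array f n i * bell_array g i m) = bell_array (g oo f) n m"
proof -
  have "bell_array (g oo f) n m = fact n * (1 / fact m) * fps_nth (g ^ m oo f) n"
    by (simp add: bell_array_def fps_compose_power[OF f0])
  also have "\<dots> = (\<Sum>i=0..n. fact n * (1 / fact m) * (fps_nth (g ^ m) i * fps_nth (f ^ i) n))"
    by (simp add: fps_compose_nth sum_distrib_left)
  also have "\<dots> = (\<Sum>i=1..n. fact n * (1 / fact m) * (fps_nth (g ^ m) i * fps_nth (f ^ i) n))"
    using n by (simp add: sum.atLeast_Suc_atMost)
  also have "\<dots> = (\<Sum>i=1..n. bell_array f n i * bell_array g i m)"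
    by (intro sum.cong) (auto simp: bell_array_def field_simps)
  finally show ?thesis by simp
qed

lemma inverse_arrays_bell_array:
  assumes "fps_nth f 0 = 0" "fps_nth g 0 = 0" "f oo g = fps_X" "g oo f = fps_X"
  shows "inverse_arrays (bell_array f) (bell_array g)"
  using assms by (auto simp: inverse_arrays_def bell_array_compose[unfolded One_nat_def] bell_array_X)

lemma fps_deriv_divided_power:
  fixes f :: "real fps"
  shows "fps_deriv (fps_const (1 / fact (Suc m)) * f ^ Suc m) =
           fps_const (1 / fact m) * f ^ m * fps_deriv f"
proof -
  have "fps_const (1 / fact (Suc m)) * fps_const (of_nat (Suc m)) = fps_const (1 / fact m :: real)"
    by (simp add: divide_simps)
  then show ?thesis
    by (simp only: fps_deriv_mult_const_left fps_deriv_power mult.assoc[symmetric] diff_Suc_1)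
      (simp only: mult_ac)
qed

text \<open>
  Differentiating a column lowers both indices by one. Hence a first-order differential equation
  for \<open>f\<close> turns into a triangular recurrence for its array, which is how the Stirling
  numbers of both kinds are recognised below.
\<close>
lemma bell_array_Suc_Suc:
  "bell_array f (Suc n) (Suc m) =
     fact n * fps_nth (fps_const (1 / fact m) * f ^ m * fps_deriv f) n"
proof -
  have "bell_array f (Suc n) (Suc m) =
          fact n * fps_nth (fps_deriv (fps_const (1 / fact (Suc m)) * f ^ Suc m)) n"
    unfolding bell_array_def fps_deriv_nth by (simp add: algebra_simps del: power_Suc)
  then show ?thesis
    by (simp only: fps_deriv_divided_power)
qed

section \<open>Compositional inverses from mutually inverse differential equations\<close>

text \<open>
  Writing \<open>y = g(u)\<close>, the hypotheses read \<open>du/dy = 1 / p(y)\<close> for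
  \<open>u = f(y)\<close> and \<open>dy/du = p(y)\<close>. This serves both pairs: \<open>p = 1 + 2y\<close> for the
  logarithm and exponential, \<open>p = 1 - y\<^sup>2\<close> for \<open>artanh\<close> and
  \<open>tanh\<close>. The differential equations give only \<open>f oo g\<close> directly; the
  other order follows because \<open>f\<close> has a left inverse, which must be \<open>g\<close>.
\<close>
lemma fps_X_compose_inverseI:
  fixes f g p :: "real fps"
  assumes f0: "fps_nth f 0 = 0" and g0: "fps_nth g 0 = 0"
    and f': "p * fps_deriv f = 1" and g': "fps_deriv g = p oo g"
  shows "f oo g = fps_X" "g oo f = fps_X"
proof -
  have "fps_deriv (f oo g) = (p * fps_deriv f) oo g"
    by (simp add: fps_compose_deriv[OF g0] g' fps_compose_mult_distrib[OF g0] mult.commute)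
  then have "fps_deriv (f oo g) = fps_deriv fps_X"
    by (simp add: f')
  then show fg: "f oo g = fps_X"
    by (simp add: fps_deriv_eq_iff f0 del: fps_deriv_fps_X)
  have "fps_nth (p * fps_deriv f) 0 = 1"
    by (simp add: f')
  then have f1: "fps_nth f 1 \<noteq> 0"
    by auto
  have "g = (fps_inv f oo f) oo g"
    by (simp add: fps_inv[OF f0 f1] g0)
  also have "\<dots> = fps_inv f"
    by (simp add: fps_compose_assoc[OF g0 f0, symmetric] fg)
  finally have "g = fps_inv f" .
  then show "g oo f = fps_X"
    by (simp add: fps_inv[OF f0 f1])
qed

lemma fps_deriv_ln_linear:
  fixes c :: real
  shows "(1 + fps_const c * fps_X) * fps_deriv (fps_ln 1 oo (fps_const c * fps_X)) = fps_const c"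
proof -
  have "(1 + fps_X) * fps_deriv (fps_ln 1) = (1 :: real fps)"
    by (simp add: fps_ln_deriv inverse_mult_eq_1')
  then have "((1 + fps_X) * fps_deriv (fps_ln 1)) oo (fps_const c * fps_X) = 1"
    by simp
  then have "(1 + fps_const c * fps_X) * (fps_deriv (fps_ln 1) oo (fps_const c * fps_X)) = 1"
    by (simp add: fps_compose_mult_distrib fps_compose_add_distrib)
  then show ?thesis
    by (simp add: fps_compose_deriv mult.assoc[symmetric])
qed

section \<open>The series and their compositions\<close>

definition half_log :: "real fps" where
  "half_log = fps_const (1/2) * (fps_ln 1 oo (fps_const 2 * fps_X))"

definition half_expm1 :: "real fps" where
  "half_expm1 = fps_const (1/2) * (fps_exp 2 - 1)"

definition lah_series :: "real fps" where
  "lah_series = fps_X * inverse (1 + fps_X)"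

lemma half_log_0: "fps_nth half_log 0 = 0"
  by (simp add: half_log_def fps_ln_def)

lemma half_expm1_0: "fps_nth half_expm1 0 = 0"
  by (simp add: half_expm1_def)

lemma fps_artanh_0: "fps_nth fps_artanh 0 = 0"
  by (simp add: fps_artanh_def)

lemma fps_deriv_half_log: "(1 + fps_const 2 * fps_X) * fps_deriv half_log = 1"
proof -
  have "(1 + fps_const 2 * fps_X) * fps_deriv half_log =
      fps_const (1/2) * ((1 + fps_const 2 * fps_X) *
        fps_deriv (fps_ln 1 oo (fps_const 2 * fps_X)))"
    unfolding half_log_def by (simp only: fps_deriv_mult_const_left mult_ac)
  also have "\<dots> = 1"
    unfolding fps_deriv_ln_linear by simp
  finally show ?thesis .
qed

lemma fps_deriv_half_expm1: "fps_deriv half_expm1 = 1 + fps_const 2 * half_expm1"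
proof -
  have "fps_const (2::real) * fps_const (1/2) = 1"
    by simp
  then show ?thesis
    unfolding half_expm1_def
    by (simp only: mult.assoc[symmetric] fps_deriv_mult_const_left) (simp add: mult.assoc[symmetric])
qed

lemma half_log_half_expm1_inverse:
  "half_log oo half_expm1 = fps_X" "half_expm1 oo half_log = fps_X"
proof -
  have "fps_deriv half_expm1 = (1 + fps_const 2 * fps_X) oo half_expm1"
    by (simp add: fps_deriv_half_expm1 fps_compose_add_distrib fps_compose_mult_distrib
        half_expm1_0)
  from fps_X_compose_inverseI[OF half_log_0 half_expm1_0 fps_deriv_half_log this]
  show "half_log oo half_expm1 = fps_X" "half_expm1 oo half_log = fps_X" .
qed

lemma fps_tanh_mult: "fps_tanh * (fps_exp 1 + fps_exp (-1)) = fps_exp 1 - fps_exp (-1)"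
proof -
  have "fps_nth (fps_exp 1 + fps_exp (-1) :: real fps) 0 \<noteq> 0"
    by simp
  from inverse_mult_eq_1[OF this] show ?thesis
    unfolding fps_tanh_def
    by (simp add: fps_divide_unit mult.assoc)
qed

lemma fps_tanh_0: "fps_nth fps_tanh 0 = 0"
  using arg_cong[OF fps_tanh_mult, of "\<lambda>f. fps_nth f 0"] by simp

lemma fps_exp_sum_nonzero: "fps_exp 1 + fps_exp (-1) \<noteq> (0 :: real fps)"
  by (simp add: fps_nonzero_nth) (rule exI[of _ 0], simp)

lemma fps_deriv_tanh: "fps_deriv fps_tanh = 1 - fps_tanh ^ 2"
proof -
  let ?D = "fps_exp 1 + fps_exp (-1) :: real fps"
  have "fps_deriv (fps_tanh * ?D) = fps_deriv (fps_exp 1 - fps_exp (-1))"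
    by (simp only: fps_tanh_mult)
  then have "fps_tanh * (fps_exp 1 - fps_exp (-1)) + fps_deriv fps_tanh * ?D = ?D"
    by (simp add: fps_const_neg[symmetric] del: fps_const_neg)
  then have "(fps_deriv fps_tanh - (1 - fps_tanh ^ 2)) * ?D = 0"
    unfolding fps_tanh_mult[symmetric] by (simp add: algebra_simps power2_eq_square)
  with fps_exp_sum_nonzero show ?thesis
    by simp
qed

lemma fps_deriv_artanh: "(1 - fps_X ^ 2) * fps_deriv fps_artanh = 1"
proof -
  define p q :: "real fps" where "p = fps_deriv (fps_ln 1)" and "q = fps_deriv (fps_ln 1 oo (- fps_X))"
  have p: "(1 + fps_X) * p = 1"
    using fps_deriv_ln_linear[of 1] by (simp add: p_def)
  have q: "(1 - fps_X) * q = - 1"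
    using fps_deriv_ln_linear[of "-1"]
    by (simp add: q_def fps_const_neg[symmetric] del: fps_const_neg)
  have "(1 - fps_X ^ 2) * fps_deriv fps_artanh =
      fps_const (1/2) * ((1 - fps_X) * ((1 + fps_X) * p) - (1 + fps_X) * ((1 - fps_X) * q))"
    unfolding fps_artanh_def fps_deriv_mult_const_left fps_deriv_sub p_def[symmetric] q_def[symmetric]
    by (simp add: algebra_simps power2_eq_square)
  also have "\<dots> = fps_const (1/2) * fps_const 2"
    unfolding p q by (simp add: numeral_fps_const[symmetric])
  also have "\<dots> = 1" by simp
  finally show ?thesis .
qed

lemma fps_artanh_tanh_inverse:
  "fps_artanh oo fps_tanh = fps_X" "fps_tanh oo fps_artanh = fps_X"
proof -
  have "fps_deriv fps_tanh = (1 - fps_X ^ 2) oo fps_tanh"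
    by (simp add: fps_deriv_tanh fps_compose_sub_distrib fps_compose_power[symmetric] fps_tanh_0)
  from fps_X_compose_inverseI[OF fps_artanh_0 fps_tanh_0 fps_deriv_artanh this]
  show "fps_artanh oo fps_tanh = fps_X" "fps_tanh oo fps_artanh = fps_X" .
qed

lemma lah_series_0: "fps_nth lah_series 0 = 0"
  by (simp add: lah_series_def)

lemma lah_series_mult: "lah_series * (1 + fps_X) = fps_X"
  by (simp add: lah_series_def mult.assoc inverse_mult_eq_1)

text \<open>
  With \<open>E = exp (2u)\<close>, both sides are \<open>(E - 1) / (E + 1)\<close>. To stay clear of
  divisions, both are characterised as the \<open>z\<close> with \<open>z * (1 + y) = y\<close>, where
  \<open>y = (E - 1) / 2\<close>.
\<close>
lemma lah_series_half_expm1: "lah_series oo half_expm1 = fps_tanh"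
proof -
  let ?E = "fps_exp 1 :: real fps" and ?F = "fps_exp (-1) :: real fps"
  have EF: "?E * ?F = 1" and E2: "fps_exp 2 = ?E * ?E"
    using fps_exp_add_mult[of "1::real" "-1"] fps_exp_add_mult[of "1::real" 1] by simp_all
  have "(lah_series * (1 + fps_X)) oo half_expm1 = fps_X oo half_expm1"
    by (simp only: lah_series_mult)
  then have L: "(lah_series oo half_expm1) * (1 + half_expm1) = half_expm1"
    by (simp add: fps_compose_mult_distrib fps_compose_add_distrib half_expm1_0)
  have "fps_const (1/2) * (?E * (fps_tanh * (?E + ?F))) = fps_const (1/2) * (?E * (?E - ?F))"
    by (simp only: fps_tanh_mult)
  then have "fps_tanh * (fps_const (1/2) * (?E * ?E + 1)) = half_expm1"
    by (simp add: half_expm1_def E2 algebra_simps EF)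
  moreover have "fps_const (1/2) * (?E * ?E + 1) = 1 + half_expm1"
  proof -
    have "fps_const (1/2) + fps_const (1/2) = (1 :: real fps)" by simp
    then show ?thesis
      by (simp add: half_expm1_def E2 algebra_simps del: fps_const_add)
  qed
  ultimately have "fps_tanh * (1 + half_expm1) = half_expm1"
    by (simp only:)
  with L have "((lah_series oo half_expm1) - fps_tanh) * (1 + half_expm1) = 0"
    by (simp only: left_diff_distrib) simp
  moreover have "1 + half_expm1 \<noteq> 0"
    by (simp add: fps_nonzero_nth) (rule exI[of _ 0], simp add: half_expm1_0)
  ultimately show ?thesis
    by simp
qed

lemma tanh_half_log: "fps_tanh oo half_log = lah_series"
  by (simp flip: lah_series_half_expm1
      add: fps_compose_assoc[symmetric] half_log_0 half_expm1_0 half_log_half_expm1_inverse)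

lemma artanh_lah_series: "fps_artanh oo lah_series = half_log"
  by (simp flip: tanh_half_log
      add: fps_compose_assoc half_log_0 fps_tanh_0 fps_artanh_tanh_inverse)

section \<open>Stirling and Lah numbers as arrays of divided powers\<close>

lemma theta_eq_bell_array: "theta = bell_array fps_artanh"
  by (intro ext) (simp add: theta_def bell_array_def)

lemma Theta_eq_bell_array: "Theta = bell_array fps_tanh"
  by (intro ext) (simp add: Theta_def bell_array_def)

lemma bell_array_0_right: "bell_array f n 0 = (if n = 0 then 1 else 0)"
  by (simp add: bell_array_def)

lemma bell_array_0_left: "fps_nth f 0 = 0 \<Longrightarrow> bell_array f 0 m = (if m = 0 then 1 else 0)"
  by (simp add: bell_array_def fps_power_zeroth)

text \<open>
  The equation \<open>y' = 1 + 2y\<close> yields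
  \<open>a(n+1, k+1) = a(n, k) + 2 (k+1) a(n, k+1)\<close>, the recurrence of the Stirling numbers of
  the second kind after scaling by \<open>2^(n-k)\<close>. For \<open>n < k\<close> the scaling factor is
  a negative power, multiplied by a vanishing Stirling number.
\<close>
lemma S_scaled_eq_bell_array: "S_scaled = bell_array half_expm1"
proof (intro ext)
  show "S_scaled n m = bell_array half_expm1 n m" for n m
  proof (induction n arbitrary: m)
    case 0
    then show ?case
      by (cases m) (simp_all add: S_scaled_def bell_array_0_left half_expm1_0)
  next
    case (Suc n)
    show ?case
    proof (cases m)
      case 0
      then show ?thesis
        by (simp add: S_scaled_def bell_array_0_right)
    next
      case m: (Suc k)
      have "fps_const (1 / fact k) * half_expm1 ^ k * fps_deriv half_expm1 =
          fps_const (1 / fact k) * half_expm1 ^ k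
          + fps_const (2 * real (Suc k)) * (fps_const (1 / fact (Suc k)) * half_expm1 ^ Suc k)"
      proof -
        have "fps_const (2 * real (Suc k)) * fps_const (1 / fact (Suc k))
            = fps_const (1 / fact k) * fps_const 2"
          by (simp add: divide_simps)
        then show ?thesis
          by (simp only: fps_deriv_half_expm1 mult.assoc[symmetric] distrib_left power_Suc2) (simp add: mult_ac)
      qed
      then have "fact n * fps_nth (fps_const (1 / fact k) * half_expm1 ^ k * fps_deriv half_expm1) n =
          bell_array half_expm1 n k + 2 * real (Suc k) * bell_array half_expm1 n (Suc k)"
        unfolding bell_array_def
        by (simp only: fps_add_nth fps_mult_left_const_nth distrib_left) (simp only: mult_ac)
      then have "bell_array half_expm1 (Suc n) (Suc k) =
          bell_array half_expm1 n k + 2 * real (Suc k) * bell_array half_expm1 n (Suc k)"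
        by (simp only: bell_array_Suc_Suc)
      also have "\<dots> = S_scaled n k + 2 * real (Suc k) * S_scaled n (Suc k)"
        by (simp only: Suc.IH)
      also have "\<dots> = S_scaled (Suc n) (Suc k)"
      proof -
        have "(2::real) * 2 powi (int n - int (Suc k)) = 2 powi (int n - int k)"
          by (simp flip: power_int_add_1' add: algebra_simps)
        then show ?thesis
          by (simp add: S_scaled_def algebra_simps)
      qed
      finally show ?thesis
        by (simp add: m)
    qed
  qed
qed

text \<open>
  The equation \<open>(1 + 2u) f' = 1\<close> yields
  \<open>a(n+1, k+1) + 2 n a(n, k+1) = a(n, k)\<close>, the recurrence of the Stirling numbers of the
  first kind after scaling by \<open>(-2)^(n-k)\<close>.
\<close>
lemma s_scaled_eq_bell_array: "s_scaled = bell_array half_log"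
proof (intro ext)
  show "s_scaled n m = bell_array half_log n m" for n m
  proof (induction n arbitrary: m)
    case 0
    then show ?case
      by (cases m) (simp_all add: s_scaled_def bell_array_0_left half_log_0)
  next
    case (Suc n)
    show ?case
    proof (cases m)
      case 0
      then show ?thesis
        by (simp add: s_scaled_def bell_array_0_right)
    next
      case m: (Suc k)
      define h where "h = fps_const (1 / fact k) * half_log ^ k * fps_deriv half_log"
      have "h + fps_const 2 * (fps_X * h) =
          fps_const (1 / fact k) * half_log ^ k * ((1 + fps_const 2 * fps_X) * fps_deriv half_log)"
        by (simp add: h_def algebra_simps)
      then have "fps_nth (h + fps_const 2 * (fps_X * h)) n =
          fps_nth (fps_const (1 / fact k) * half_log ^ k) n"
        by (simp only: fps_deriv_half_log mult_1_right)
      then have "fact n * fps_nth h n + 2 * (fact n * fps_nth (fps_X * h) n) = bell_array half_log n k"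
        by (simp only: bell_array_def fps_add_nth fps_mult_left_const_nth)
          (metis distrib_left mult.left_commute)
      moreover have "fact n * fps_nth (fps_X * h) n = real n * bell_array half_log n (Suc k)"
        by (cases n) (simp_all add: bell_array_Suc_Suc h_def)
      ultimately have "bell_array half_log (Suc n) (Suc k) =
          bell_array half_log n k - 2 * real n * bell_array half_log n (Suc k)"
        unfolding bell_array_Suc_Suc h_def by simp
      also have "\<dots> = s_scaled n k - 2 * real n * s_scaled n (Suc k)"
        by (simp only: Suc.IH)
      also have "\<dots> = s_scaled (Suc n) (Suc k)"
      proof -
        have "(-2::real) powi (int n - int k) = -2 * (-2) powi (int n - int (Suc k))"
          using power_int_add_1'[of "-2::real" "int n - int (Suc k)"] by simp
        then show ?thesis
          by (simp add: s_scaled_def algebra_simps)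
      qed
      finally show ?thesis
        by (simp add: m)
    qed
  qed
qed

text \<open>
  Since \<open>(1 + u) L = u\<close> for \<open>L = u / (1 + u)\<close>, the coefficients of the powers
  of \<open>L\<close> obey Pascal's rule up to sign. The shift of both
  indices avoids the zeroth power, whose coefficients do not fit the binomial pattern.
\<close>
lemma lah_series_power_nth:
  "fps_nth (lah_series ^ Suc m) (Suc n) = (-1) powi (int n - int m) * real (n choose m)"
proof (induction n arbitrary: m)
  have step: "fps_nth (lah_series ^ Suc m) (Suc n) =
      fps_nth (lah_series ^ m) n - fps_nth (lah_series ^ Suc m) n" for n m
  proof -
    have "lah_series ^ Suc m * (1 + fps_X) = lah_series ^ m * fps_X"
      by (simp only: power_Suc2 mult.assoc lah_series_mult)
    then have "fps_nth (lah_series ^ Suc m * (1 + fps_X)) (Suc n) =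
        fps_nth (lah_series ^ m * fps_X) (Suc n)"
      by (simp only:)
    then show ?thesis
      by (simp add: distrib_left del: power_Suc)
  qed
  {
    case 0
    show ?case
      using step[of m 0] by (cases m) (simp_all add: lah_series_0 fps_power_zeroth)
  next
    case (Suc n)
    show ?case
    proof (cases m)
      case 0
      then show ?thesis
        using Suc.IH[of 0] step[of 0 "Suc n"] power_int_add_1'[of "-1::real" "int n"]
        by (simp add: add.commute)
    next
      case m: (Suc k)
      have "(-1::real) powi (int n - int k) = - ((-1) powi (int n - int (Suc k)))"
        using power_int_add_1'[of "-1::real" "int n - int (Suc k)"] by simp
      then show ?thesis
        unfolding m step[of "Suc k" "Suc n"] Suc.IH by (simp add: algebra_simps)
    qed
  }
qed

lemma Lah_scaled_eq_bell_array:
  assumes "n \<ge> 1" "m \<ge> 1"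
  shows "Lah_scaled n m = bell_array lah_series n m"
proof -
  from assms obtain n' m' where "n = Suc n'" "m = Suc m'"
    by (metis Suc_le_D One_nat_def)
  then show ?thesis
    by (simp add: Lah_scaled_def bell_array_def lah_series_power_nth del: power_Suc fact_Suc)
qed

lemma bell_array_lah_series_1:
  assumes "n \<ge> 1"
  shows "bell_array lah_series n 1 = (-1) ^ (n - 1) * fact n"
proof -
  from assms obtain k where "n = Suc k"
    by (metis Suc_le_D One_nat_def)
  then show ?thesis
    using lah_series_power_nth[of 0 k] by (simp add: bell_array_1[unfolded One_nat_def])
qed

lemma bell_array_half_log_1:
  assumes "n \<ge> 1"
  shows "bell_array half_log n 1 = (-2) ^ (n - 1) * fact (n - 1)"
proof -
  from assms obtain k where "n = Suc k"
    by (metis Suc_le_D One_nat_def)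
  then show ?thesis
    by (simp add: s_scaled_eq_bell_array[symmetric] s_scaled_def stirling_Suc_n_1 del: stirling.simps)
qed

theorem mainTheorem9:
  shows "inverse_arrays s_scaled S_scaled \<and>
    (\<forall>n\<ge>1.
       Theta n 1 = (\<Sum>i=1..n. S_scaled n i * ((-1) ^ (i - 1) * fact i)) \<and>
       (-1) ^ (n - 1) * fact n = (\<Sum>i=1..n. s_scaled n i * Theta i 1)) \<and>
    inverse_arrays theta Theta \<and>
    (\<forall>n\<ge>1.
       (-1) ^ (n - 1) * fact n = (\<Sum>i=1..n. Theta i 1 * s_scaled n i) \<and>
       (-2) ^ (n - 1) * fact (n - 1) = (\<Sum>i=1..n. theta i 1 * Lah_scaled n i))"
proof (intro conjI allI impI)
  show "inverse_arrays s_scaled S_scaled"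
    unfolding s_scaled_eq_bell_array S_scaled_eq_bell_array
    by (intro inverse_arrays_bell_array half_log_0 half_expm1_0 half_log_half_expm1_inverse)
  show "inverse_arrays theta Theta"
    unfolding theta_eq_bell_array Theta_eq_bell_array
    by (intro inverse_arrays_bell_array fps_artanh_0 fps_tanh_0 fps_artanh_tanh_inverse)
  fix n :: nat
  assume n: "n \<ge> 1"
  have "Theta n 1 = (\<Sum>i=1..n. S_scaled n i * bell_array lah_series i 1)"
    unfolding Theta_eq_bell_array S_scaled_eq_bell_array
    by (simp only: bell_array_compose[OF half_expm1_0 n] lah_series_half_expm1)
  also have "\<dots> = (\<Sum>i=1..n. S_scaled n i * ((-1) ^ (i - 1) * fact i))"
    by (intro sum.cong refl) (simp add: bell_array_lah_series_1[unfolded One_nat_def])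
  finally show "Theta n 1 = (\<Sum>i=1..n. S_scaled n i * ((-1) ^ (i - 1) * fact i))" .
  show "(-1) ^ (n - 1) * fact n = (\<Sum>i=1..n. s_scaled n i * Theta i 1)"
    unfolding bell_array_lah_series_1[OF n, symmetric] s_scaled_eq_bell_array Theta_eq_bell_array
    by (simp only: bell_array_compose[OF half_log_0 n] tanh_half_log)
  then show "(-1) ^ (n - 1) * fact n = (\<Sum>i=1..n. Theta i 1 * s_scaled n i)"
    by (simp only: mult.commute)
  have "(\<Sum>i=1..n. theta i 1 * Lah_scaled n i) =
      (\<Sum>i=1..n. bell_array lah_series n i * bell_array fps_artanh i 1)"
    using n by (intro sum.cong) (auto simp: theta_eq_bell_array Lah_scaled_eq_bell_array)
  also have "\<dots> = (-2) ^ (n - 1) * fact (n - 1)"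
    by (simp only: bell_array_compose[OF lah_series_0 n] artanh_lah_series bell_array_half_log_1[OF n])
  finally show "(-2) ^ (n - 1) * fact (n - 1) = (\<Sum>i=1..n. theta i 1 * Lah_scaled n i)" ..
qed

end
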